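(* Let $\mathcal{M}=\bigoplus_{i=1}^{m}\mathcal{M}_i$ and $\mathcal{N}=\bigoplus_{j=1}^{k}\mathcal{N}_j$ be two $2$-parameter rectangle decomposable persistence modules, where $\mathcal{M}_i$ is the rectangle persistence module with underlying rectangle $R_i=(a_1^i,b_1^i)\times(a_2^i,b_2^i)$ and $\mathcal{N}_j$ is the rectangle persistence module with underlying rectangle $Q_j=(c_1^j,d_1^j)\times(c_2^j,d_2^j)$, with $a_s^i,c_s^j\in\mathbb{R}\cup\{-\infty\}$, $b_s^i,d_s^j\in\mathbb{R}\cup\{+\infty\}$, $a_s^i<b_s^i$, $c_s^j<d_s^j$ for $s=1,2$. Write $a^i=(a_1^i,a_2^i)$, $b^i=(b_1^i,b_2^i)$, $c^j=(c_1^j,c_2^j)$, $d^j=(d_1^j,d_2^j)$. Let $S$ be the set of all partial multibijections between the barcodes $B(\mathcal{M})=\{R_1,\dots,R_m\}$ and $B(\mathcal{N})=\{Q_1,\dots,Q_k\}$ (multisets). For $\sigma\in S$ let $\mathbf{I}'(\sigma)=B(\mathcal{M})-\operatorname{coim}\sigma$ and $\mathbf{J}'(\sigma)=B(\mathcal{N})-\operatorname{im}\sigma$, and for $R_i\in\operatorname{coim}\sigma$ write $\sigma(R_i)=Q_{\sigma(i)}$ and $\sigma(\mathcal{M}_i)=\mathcal{N}_{\sigma(i)}$. Then the bottleneck distance $d_B(\mathcal{M},\mathcal{N})$ is equal to $$\min_{\sigma\in S}\max\left\{\max_{R_i\in\operatorname{coim}\sigma}\Big\{d_I\big(\mathcal{M}_i,\sigma(\mathcal{M}_i)\big)\Big\},\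 \max_{R_{i'}\in\mathbf{I}'(\sigma)}\Big\{\min_{s=1,2}\frac{b_s^{i'}-a_s^{i'}}{2}\Big\},\ \max_{Q_{j'}\in\mathbf{J}'(\sigma)}\Big\{\min_{s=1,2}\frac{d_s^{j'}-c_s^{j'}}{2}\Big\}\right\},$$ where the interleaving distance $d_I(\mathcal{M}_i,\sigma(\mathcal{M}_i))$ is equal to $$\min\Bigg\{\max\Big\{\min_{s=1,2}\frac{b_s^i-a_s^i}{2},\ \min_{s=1,2}\frac{d_s^{\sigma(i)}-c_s^{\sigma(i)}}{2}\Big\},\ \max\Big\{\|c^{\sigma(i)}-a^i\|_\infty,\ \|d^{\sigma(i)}-b^i\|_\infty\Big\}\Bigg\}.$$
   Context: Fix a field $\mathbb{k}$. On $\mathbb{R}^n$ (here $n=2$), $u\preceq v$ means $u_i\le v_i$ for all $i$. An $n$-parameter persistence module $\mathcal{M}$ is a functor from $(\mathbb{R}^n,\preceq)$ to $\mathbb{k}$-vector spaces: vector spaces $\mathcal{M}_u$ and linear transition maps $\varphi_\mathcal{M}(u,v):\mathcal{M}_u\to\mathcal{M}_v$ for $u\preceq v$, with $\varphi_\mathcal{M}(u,u)=\mathrm{id}$ and $\varphi_\mathcal{M}(v,w)\circ\varphi_\mathcal{M}(u,v)=\varphi_\mathcal{M}(u,w)$. A morphism is a natural transformation. Direct sums are taken pointwise. The rectangle persistence module with underlying rectangle $R\subseteq\mathbb{R}^n$ ($R$ a product of $n$ one-parameter intervals), denoted $\mathcal{I}^R$, has value $\mathbb{k}$ at $u\in R$,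 value $0$ at $u\notin R$, and transition map $\mathrm{id}_\mathbb{k}$ for $u\preceq v$ both in $R$ (all other transition maps are zero). A persistence module is rectangle decomposable if it is a direct sum of rectangle persistence modules; the multiset of the underlying rectangles is its barcode $B(\mathcal{M})$. For $\epsilon\ge 0$ let $\vec\epsilon=(\epsilon,\dots,\epsilon)$, and let $\mathcal{M}(\vec\epsilon)_u=\mathcal{M}_{u+\vec\epsilon}$ with $\varphi_{\mathcal{M}(\vec\epsilon)}(u,v)=\varphi_\mathcal{M}(u+\vec\epsilon,v+\vec\epsilon)$. $\mathcal{M}$ and $\mathcal{N}$ are $\epsilon$-interleaved if there are morphisms $f:\mathcal{M}\to\mathcal{N}(\vec\epsilon)$ and $g:\mathcal{N}\to\mathcal{M}(\vec\epsilon)$ with $g_{u+\vec\epsilon}\circ f_u=\varphi_\mathcal{M}(u,u+2\vec\epsilon)$ and $f_{u+\vec\epsilon}\circ g_u=\varphi_\mathcal{N}(u,u+2\vec\epsilon)$ for all $u$. $d_I(\mathcal{M},\mathcal{N})=\inf\{\epsilon\in[0,+\infty):\mathcal{M},\mathcal{N}\text{ are }\epsilon\text{-interleaved}\}$ ($+\infty$ if there is no such $\epsilon$). $\mathcal{M}$ is $\epsilon$-trivial if $\varphi_\mathcal{M}(u,u+\vec\epsilon)=0$ for all $u$. A partial multibijection $\sigma:A\nrightarrow B$ between multisets is a bijection from a sub-multiset $\operatorname{coim}\sigma$ of $A$ onto a sub-multiset $\operatorname{im}\sigma$ of $B$ (elements counted with multiplicity, i.e. a partial injective matching of indices). An $\epsilon$-matching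 is a partial multibijection $\sigma$ such that $\mathcal{I}^I$ is $2\epsilon$-trivial for all $I\in A-\operatorname{coim}\sigma$ and all $I\in B-\operatorname{im}\sigma$, and $\mathcal{I}^I$, $\mathcal{I}^{\sigma(I)}$ are $\epsilon$-interleaved for all $I\in\operatorname{coim}\sigma$. The bottleneck distance is $d_B(\mathcal{M},\mathcal{N})=\inf\{\epsilon\in[0,+\infty):\text{there is an }\epsilon\text{-matching between }B(\mathcal{M})\text{ and }B(\mathcal{N})\}$ ($+\infty$ if there is no such $\epsilon$). $\|u\|_\infty=\max_i|u_i|$. Conventions in $\overline{\mathbb{R}}=\mathbb{R}\cup\{\pm\infty\}$: $x+(\pm\infty)=\pm\infty$ for $x\in\mathbb{R}$; $(+\infty)+(+\infty)=+\infty$ and $(-\infty)+(-\infty)=-\infty$ (so $(+\infty)-(-\infty)=+\infty$); $(+\infty)-(+\infty)=0$ and $(-\infty)-(-\infty)=0$; $|\pm\infty|=+\infty$. A maximum over an empty set is read as $0$. *)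

theory Defs
  imports "HOL-Analysis.Analysis" "HOL-Library.Function_Algebras" "HOL-Library.Multiset"
begin

section \<open>Persistence modules\<close>

text \<open>
  The vector spaces of an n-parameter persistence module over the field \<open>'k\<close> are subspaces
  \<open>fibre M u\<close> of one ambient \<open>'k\<close>-vector space on the type \<open>'v\<close>, with scalar multiplication
  \<open>scl M\<close>. This is no restriction, since any family of vector spaces embeds into its direct sum.
  The maps \<open>tr M u v\<close> matter only on \<open>fibre M u\<close> and for \<open>u \<le> v\<close>; the order on \<^typ>\<open>real^'n\<close> is
  the componentwise one.
\<close>

record ('k, 'v, 'n) pmod =
  scl :: "'k \<Rightarrow> 'v \<Rightarrow> 'v"
  fibre :: "real^'n \<Rightarrow> 'v set"
  tr :: "real^'n \<Rightarrow> real^'n \<Rightarrow> 'v \<Rightarrow> 'v"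

definition linear_between ::
  "('k \<Rightarrow> 'v \<Rightarrow> 'v) \<Rightarrow> 'v set \<Rightarrow> ('k \<Rightarrow> 'w \<Rightarrow> 'w) \<Rightarrow> 'w set
    \<Rightarrow> ('v::ab_group_add \<Rightarrow> 'w::ab_group_add) \<Rightarrow> bool" where
  "linear_between s V t W f \<longleftrightarrow>
    (\<forall>x\<in>V. f x \<in> W) \<and>
    (\<forall>x\<in>V. \<forall>y\<in>V. f (x + y) = f x + f y) \<and>
    (\<forall>r. \<forall>x\<in>V. f (s r x) = t r (f x))"

definition persistence_module ::
  "('k::field, 'v::ab_group_add, 'n::finite) pmod \<Rightarrow> bool" where
  "persistence_module M \<longleftrightarrow>
    vector_space (scl M) \<and>
    (\<forall>u. module.subspace (scl M) (fibre M u)) \<and>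
    (\<forall>u v. u \<le> v \<longrightarrow> linear_between (scl M) (fibre M u) (scl M) (fibre M v) (tr M u v)) \<and>
    (\<forall>u. \<forall>x\<in>fibre M u. tr M u u x = x) \<and>
    (\<forall>u v w. u \<le> v \<longrightarrow> v \<le> w \<longrightarrow> (\<forall>x\<in>fibre M u. tr M v w (tr M u v x) = tr M u w x))"

definition morphism ::
  "('k::field, 'v::ab_group_add, 'n::finite) pmod \<Rightarrow> ('k, 'w::ab_group_add, 'n) pmod
    \<Rightarrow> (real^'n \<Rightarrow> 'v \<Rightarrow> 'w) \<Rightarrow> bool" where
  "morphism M N f \<longleftrightarrow>
    (\<forall>u. linear_between (scl M) (fibre M u) (scl N) (fibre N u) (f u)) \<and>
    (\<forall>u v. u \<le> v \<longrightarrow> (\<forall>x\<in>fibre M u. f v (tr M u v x) = tr N u v (f u x)))"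

definition isomorphic ::
  "('k::field, 'v::ab_group_add, 'n::finite) pmod \<Rightarrow> ('k, 'w::ab_group_add, 'n) pmod \<Rightarrow> bool" where
  "isomorphic M N \<longleftrightarrow>
    (\<exists>f g. morphism M N f \<and> morphism N M g \<and>
      (\<forall>u. \<forall>x\<in>fibre M u. g u (f u x) = x) \<and>
      (\<forall>u. \<forall>y\<in>fibre N u. f u (g u y) = y))"

definition direct_sum ::
  "'i set \<Rightarrow> ('i \<Rightarrow> ('k::field, 'v::ab_group_add, 'n::finite) pmod) \<Rightarrow> ('k, 'i \<Rightarrow> 'v, 'n) pmod" where
  "direct_sum I X = \<lparr>
    scl = (\<lambda>r f i. scl (X i) r (f i)),
    fibre = (\<lambda>u. {f. finite {i. f i \<noteq> 0} \<and> (\<forall>i\<in>I. f i \<in> fibre (X i) u) \<and> (\<forall>i. i \<notin> I \<longrightarrow> f i = 0)}),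
    tr = (\<lambda>u v f i. if i \<in> I then tr (X i) u v (f i) else 0)\<rparr>"


section \<open>Rectangle modules and barcodes\<close>

definition rectangle :: "(real^'n::finite) set \<Rightarrow> bool" where
  "rectangle R \<longleftrightarrow>
    (\<exists>J :: 'n \<Rightarrow> real set. (\<forall>s. is_interval (J s) \<and> J s \<noteq> {}) \<and> R = {u. \<forall>s. u $ s \<in> J s})"

definition rect_module :: "(real^'n::finite) set \<Rightarrow> ('k::field, 'k, 'n) pmod" where
  "rect_module R = \<lparr>
    scl = (*),
    fibre = (\<lambda>u. if u \<in> R then UNIV else {0}),
    tr = (\<lambda>u v x. if u \<in> R \<and> v \<in> R then x else 0)\<rparr>"

text \<open>
  The copies of the elements of a multiset, serving as indices: \<open>fst\<close> is the element itself.
\<close>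

definition instances :: "'a multiset \<Rightarrow> ('a \<times> nat) set" where
  "instances B = {(x, l). l < count B x}"

text \<open>
  Only finite direct sums of rectangle modules have a barcode here. The barcode is unique because
  rectangles are nonempty by definition.
\<close>

definition is_barcode ::
  "('k::field, 'v::ab_group_add, 'n::finite) pmod \<Rightarrow> (real^'n) set multiset \<Rightarrow> bool" where
  "is_barcode M B \<longleftrightarrow>
    (\<forall>R\<in>#B. rectangle R) \<and> isomorphic M (direct_sum (instances B) (\<lambda>p. rect_module (fst p)))"

definition barcode ::
  "('k::field, 'v::ab_group_add, 'n::finite) pmod \<Rightarrow> (real^'n) set multiset" where
  "barcode M = (THE B. is_barcode M B)"


section \<open>Interleaving distance\<close>

definition shift ::
  "real \<Rightarrow> ('k, 'v, 'n::finite) pmod \<Rightarrow> ('k, 'v, 'n) pmod" where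
  "shift e M = \<lparr>
    scl = scl M,
    fibre = (\<lambda>u. fibre M (u + vec e)),
    tr = (\<lambda>u v. tr M (u + vec e) (v + vec e))\<rparr>"

definition interleaved ::
  "real \<Rightarrow> ('k::field, 'v::ab_group_add, 'n::finite) pmod \<Rightarrow> ('k, 'w::ab_group_add, 'n) pmod \<Rightarrow> bool"
  where
  "interleaved e M N \<longleftrightarrow>
    (\<exists>f g. morphism M (shift e N) f \<and> morphism N (shift e M) g \<and>
      (\<forall>u. \<forall>x\<in>fibre M u. g (u + vec e) (f u x) = tr M u (u + vec (2 * e)) x) \<and>
      (\<forall>u. \<forall>y\<in>fibre N u. f (u + vec e) (g u y) = tr N u (u + vec (2 * e)) y))"

definition interleaving_dist ::
  "('k::field, 'v::ab_group_add, 'n::finite) pmod \<Rightarrow> ('k, 'w::ab_group_add, 'n) pmod \<Rightarrow> ereal" where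
  "interleaving_dist M N = Inf {ereal e | e. 0 \<le> e \<and> interleaved e M N}"

definition eps_trivial :: "real \<Rightarrow> ('k, 'v::zero, 'n::finite) pmod \<Rightarrow> bool" where
  "eps_trivial e M \<longleftrightarrow> (\<forall>u. \<forall>x\<in>fibre M u. tr M u (u + vec e) x = 0)"


section \<open>Bottleneck distance\<close>

text \<open>
  Multisets are given by families, so a partial multibijection is a partial injection \<open>\<sigma>\<close>
  between the index sets; its coimage is \<open>dom \<sigma>\<close> and its image is \<open>ran \<sigma>\<close>.
\<close>

definition partial_multibijections :: "'i set \<Rightarrow> 'j set \<Rightarrow> ('i \<rightharpoonup> 'j) set" where
  "partial_multibijections I J = {\<sigma>. dom \<sigma> \<subseteq> I \<and> ran \<sigma> \<subseteq> J \<and> inj_on \<sigma> (dom \<sigma>)}"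

definition eps_matching ::
  "real \<Rightarrow> 'i set \<Rightarrow> ('i \<Rightarrow> ('k::field, 'v::ab_group_add, 'n::finite) pmod)
    \<Rightarrow> 'j set \<Rightarrow> ('j \<Rightarrow> ('k, 'w::ab_group_add, 'n) pmod) \<Rightarrow> ('i \<rightharpoonup> 'j) \<Rightarrow> bool" where
  "eps_matching e I X J Y \<sigma> \<longleftrightarrow>
    \<sigma> \<in> partial_multibijections I J \<and>
    (\<forall>i\<in>I - dom \<sigma>. eps_trivial (2 * e) (X i)) \<and>
    (\<forall>j\<in>J - ran \<sigma>. eps_trivial (2 * e) (Y j)) \<and>
    (\<forall>i\<in>dom \<sigma>. interleaved e (X i) (Y (the (\<sigma> i))))"

definition bottleneck_dist ::
  "('k::field, 'v::ab_group_add, 'n::finite) pmod \<Rightarrow> ('k, 'w::ab_group_add, 'n) pmod \<Rightarrow> ereal" where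
  "bottleneck_dist M N = Inf {ereal e | e. 0 \<le> e \<and>
    (\<exists>\<sigma>. eps_matching e
      (instances (barcode M)) (\<lambda>p. rect_module (fst p) :: ('k, 'k, 'n) pmod)
      (instances (barcode N)) (\<lambda>p. rect_module (fst p) :: ('k, 'k, 'n) pmod) \<sigma>)}"


section \<open>Extended coordinates\<close>

definition open_rect :: "ereal^'n \<Rightarrow> ereal^'n \<Rightarrow> (real^'n::finite) set" where
  "open_rect a b = {u. \<forall>s. a $ s < ereal (u $ s) \<and> ereal (u $ s) < b $ s}"

text \<open>
  Unlike the subtraction of \<^typ>\<open>ereal\<close>, this one makes the difference of equal infinities zero.
\<close>

definition ext_diff :: "ereal \<Rightarrow> ereal \<Rightarrow> ereal" where
  "ext_diff x y = (if x = y then 0 else x - y)"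

definition sup_norm_diff :: "ereal^'n::finite \<Rightarrow> ereal^'n \<Rightarrow> ereal" where
  "sup_norm_diff x y = (MAX s. \<bar>ext_diff (x $ s) (y $ s)\<bar>)"

definition Max0 :: "ereal set \<Rightarrow> ereal" where
  "Max0 A = (if A = {} then 0 else Max A)"

end

theory Submission
  imports Defs
begin

text \<open>
  For \<open>u \<le> v\<close>, the rank of the transition map from \<open>u\<close> to \<open>v\<close> counts the rectangles of a decomposition
  that contain both points. These ranks determine the decomposition: cancel the common part of two
  barcodes and take an inclusion-maximal remaining rectangle \<open>R\<close>. Each rectangle of the other
  barcode misses a point of \<open>R\<close>; the corners \<open>u \<le> v\<close> of a box in \<open>R\<close> around these finitely many
  points lie in \<open>R\<close> but in no rectangle of the other barcode, so the ranks at \<open>(u, v)\<close> differ.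

  For single open rectangles and a real \<open>e \<ge> 0\<close>, being \<open>2e\<close>-trivial and being \<open>e\<close>-interleaved are
  equivalent to comparing \<open>e\<close> with the corresponding closed formula, so the infimum in every
  distance is attained if finite. A nonzero morphism \<open>I\<^sup>R \<rightarrow> I\<^sup>Q(e)\<close> forces the lower
  and upper corners of \<open>Q\<close> shifted by \<open>-e\<close> to lie weakly below those of \<open>R\<close>; hence an interleaving
  of rectangles that are not both \<open>2e\<close>-trivial gives the bound on the corner distances.
\<close>

section \<open>Interleavings of open rectangles\<close>

lemma half_width_coord:
  fixes \<alpha> \<beta> :: ereal
  assumes "\<alpha> \<noteq> \<infinity>" "\<beta> \<noteq> -\<infinity>" "\<alpha> < \<beta>" "0 \<le> e"
  shows "ereal e < ext_diff \<beta> \<alpha> / 2 \<longleftrightarrow> (\<exists>x. \<alpha> < ereal x \<and> ereal (x + 2 * e) < \<beta>)"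
proof (cases \<alpha>)
  case (real p)
  show ?thesis
  proof (cases \<beta>)
    case r: (real q)
    have "ereal e < ext_diff \<beta> \<alpha> / 2 \<longleftrightarrow> p + 2 * e < q"
      using assms real r by (auto simp: ext_diff_def numeral_eq_ereal field_simps)
    also have "\<dots> \<longleftrightarrow> (\<exists>x. p < x \<and> x + 2 * e < q)"
    proof
      assume "p + 2 * e < q"
      \<comment> \<open>The admissible \<open>x\<close> form the open interval from \<open>p\<close>
        to \<open>q - 2 * e\<close>; the witness is its midpoint. Open sides are the reason for the
        strict inequality: an open interval of length exactly \<open>2 * e\<close> does not contain
        two points at that distance.\<close>
      then show "\<exists>x. p < x \<and> x + 2 * e < q"
        by (intro exI[of _ "(p + q - 2 * e) / 2"]) (simp add: field_simps)
    qed auto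
    finally show ?thesis using real r by simp
  qed (use assms real in \<open>auto simp: ext_diff_def intro: gt_ex\<close>)
next
  case MInf
  show ?thesis
  proof (cases \<beta>)
    case r: (real q)
    then show ?thesis using MInf by (auto simp: ext_diff_def intro!: exI[of _ "q - 2 * e - 1"])
  qed (use assms MInf in \<open>auto simp: ext_diff_def\<close>)
qed (use assms in auto)

text \<open>The additive form avoids subtracting infinities: equal infinities satisfy both
  inequalities, and an infinite coordinate facing a different value violates one of them.\<close>

lemma abs_ext_diff_le_iff:
  assumes "0 \<le> e"
  shows "\<bar>ext_diff x y\<bar> \<le> ereal e \<longleftrightarrow> x \<le> y + ereal e \<and> y \<le> x + ereal e"
  using assms by (cases x; cases y) (auto simp: ext_diff_def)

definition half_width :: "ereal^'n::finite \<Rightarrow> ereal^'n \<Rightarrow> ereal" where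
  "half_width a b = (MIN s. ext_diff (b $ s) (a $ s) / 2)"

definition proper_bounds :: "ereal^'n \<Rightarrow> ereal^'n \<Rightarrow> bool" where
  "proper_bounds a b \<longleftrightarrow> (\<forall>s. a $ s \<noteq> \<infinity> \<and> b $ s \<noteq> -\<infinity> \<and> a $ s < b $ s)"

text \<open>The coordinates of a point of a rectangle can be chosen independently. So a pair of
  points differing by \<open>vec (2 * e)\<close> fits into the rectangle as soon as each side
  separately has room for such a pair.\<close>

lemma half_width_le_iff:
  assumes "proper_bounds a b" "0 \<le> e"
  shows "half_width a b \<le> ereal e \<longleftrightarrow> (\<forall>u. u \<in> open_rect a b \<longrightarrow> u + vec (2 * e) \<notin> open_rect a b)"
proof -
  have "\<not> half_width a b \<le> ereal e \<longleftrightarrow> (\<forall>s. ereal e < ext_diff (b $ s) (a $ s) / 2)"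
    by (simp add: half_width_def not_le)
  also have "\<dots> \<longleftrightarrow> (\<forall>s. \<exists>x. a $ s < ereal x \<and> ereal (x + 2 * e) < b $ s)"
    using half_width_coord[of "a $ s" "b $ s" e for s] assms unfolding proper_bounds_def by meson
  also have "\<dots> \<longleftrightarrow> (\<exists>u. u \<in> open_rect a b \<and> u + vec (2 * e) \<in> open_rect a b)"
  proof
    assume "\<forall>s. \<exists>x. a $ s < ereal x \<and> ereal (x + 2 * e) < b $ s"
    then obtain x where x: "\<And>s. a $ s < ereal (x s) \<and> ereal (x s + 2 * e) < b $ s" by metis
    have "a $ s < ereal (x s + 2 * e)" "ereal (x s) < b $ s" for s
      using x[of s] \<open>0 \<le> e\<close> by (auto elim!: less_le_trans le_less_trans[rotated])
    with x show "\<exists>u. u \<in> open_rect a b \<and> u + vec (2 * e) \<in> open_rect a b"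
      by (intro exI[of _ "\<chi> s. x s"]) (simp add: open_rect_def)
  qed (auto simp: open_rect_def)
  finally show ?thesis by blast
qed

lemma sup_norm_diff_le_iff:
  assumes "0 \<le> e"
  shows "sup_norm_diff x y \<le> ereal e \<longleftrightarrow> (\<forall>s. x $ s \<le> y $ s + ereal e \<and> y $ s \<le> x $ s + ereal e)"
  using assms by (simp add: sup_norm_diff_def abs_ext_diff_le_iff)

lemma half_width_nonneg:
  assumes "proper_bounds a b"
  shows "0 \<le> half_width a b"
proof -
  have "0 \<le> ext_diff (b $ s) (a $ s) / 2" for s
    using assms unfolding proper_bounds_def ext_diff_def
    by (cases "a $ s"; cases "b $ s") (auto dest: spec[of _ s] simp: numeral_eq_ereal)
  then show ?thesis by (simp add: half_width_def)
qed

lemma sup_norm_diff_nonneg: "0 \<le> sup_norm_diff x y"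
  by (auto simp: sup_norm_diff_def Max_ge_iff)

section \<open>Morphisms between rectangle modules\<close>

lemma rect_module_simps [simp]:
  "scl (rect_module R) = (*)"
  "fibre (rect_module R) u = (if u \<in> R then UNIV else {0})"
  "tr (rect_module R) u v x = (if u \<in> R \<and> v \<in> R then x else 0)"
  by (simp_all add: rect_module_def)

lemma shift_simps [simp]:
  "scl (shift e M) = scl M"
  "fibre (shift e M) u = fibre M (u + vec e)"
  "tr (shift e M) u v = tr M (u + vec e) (v + vec e)"
  by (simp_all add: shift_def)

lemma eps_trivial_rect_iff:
  assumes "proper_bounds a b" "0 \<le> e"
  shows "eps_trivial (2 * e) (rect_module (open_rect a b) :: ('k::field, 'k, 'n::finite) pmod)
    \<longleftrightarrow> half_width a b \<le> ereal e"
proof -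
  have "\<not> (\<forall>x::'k. x = 0)" by (metis one_neq_zero)
  then show ?thesis
    unfolding half_width_le_iff[OF assms] eps_trivial_def by auto
qed

lemma morphism_zero:
  assumes "morphism M N f" "0 \<in> fibre M u"
  shows "f u 0 = 0"
proof -
  have "f u (0 + 0) = f u 0 + f u 0"
    using assms unfolding morphism_def linear_between_def by blast
  then show ?thesis by simp
qed

lemma morphism_rect_eq_0:
  assumes "morphism (rect_module R) (shift e (rect_module Q)) f"
    and "x \<in> fibre (rect_module R) u" "u \<notin> R \<or> u + vec e \<notin> Q"
  shows "f u x = 0"
proof (cases "u \<in> R")
  case True
  have "f u x \<in> fibre (shift e (rect_module Q)) u"
    using assms unfolding morphism_def linear_between_def by blast
  then show ?thesis using True assms(3) by simp
next
  case False
  then show ?thesis using assms morphism_zero[OF assms(1), of u] by simp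
qed

text \<open>Both bounds come from a naturality square whose second corner \<open>w\<close> differs
  from \<open>u\<close> in coordinate \<open>s\<close> only. If the lower bound fails, some
  \<open>w \<le> u\<close> lies in the source rectangle while \<open>w + vec e\<close> lies outside
  the target, so \<open>f u x\<close> factors through a zero space. If the upper bound fails, some
  \<open>w \<ge> u\<close> lies outside the source while \<open>w + vec e\<close> lies in the
  target; there the target preserves \<open>f u x\<close>, but the source has already sent
  \<open>x\<close> to zero.\<close>

lemma morphism_rect_imp_le:
  fixes f :: "real^'n::finite \<Rightarrow> 'k::field \<Rightarrow> 'k"
  assumes f: "morphism (rect_module (open_rect a b)) (shift e (rect_module (open_rect c d))) f"
    and "u \<in> open_rect a b" "f u x \<noteq> 0"
  shows "c $ s \<le> a $ s + ereal e" "d $ s \<le> b $ s + ereal e"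
proof -
  have nat: "f v (tr (rect_module (open_rect a b)) u v y) =
      tr (rect_module (open_rect c d)) (u + vec e) (v + vec e) (f u y)"
    if "u \<le> v" "y \<in> fibre (rect_module (open_rect a b)) u" for u v y
    using f that unfolding morphism_def shift_simps by blast
  have zero: "f v 0 = 0" for v using morphism_zero[OF f] by simp
  have ue: "u + vec e \<in> open_rect c d" using morphism_rect_eq_0[OF f, of x u] assms by auto
  show "c $ s \<le> a $ s + ereal e"
  proof (rule ccontr)
    assume "\<not> ?thesis"
    then have "a $ s < c $ s - ereal e" by (simp add: ereal_less_minus)
    then obtain r where r: "a $ s < ereal r" "ereal r < c $ s - ereal e" using ereal_dense2 by blast
    then have r2: "\<not> c $ s < ereal (r + e)" by (cases "c $ s") auto
    define w where "w = (\<chi> i. if i = s then r else u $ i)"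
    have "c $ s < ereal (u $ s + e)" using ue by (simp add: open_rect_def)
    with r2 have "r < u $ s"
      by (metis add_less_cancel_right less_ereal.simps(1) not_less_iff_gr_or_eq less_trans)
    then have "w \<le> u" by (simp add: w_def less_eq_vec_def)
    moreover have "w \<in> open_rect a b" using assms(2) r \<open>r < u $ s\<close>
      by (auto simp: open_rect_def w_def intro: less_trans[of "ereal r" "ereal (u $ s)"])
    moreover have "w + vec e \<notin> open_rect c d" using r2 by (auto simp: open_rect_def w_def)
    ultimately show False using nat[of w u x] assms by simp
  qed
  show "d $ s \<le> b $ s + ereal e"
  proof (rule ccontr)
    assume "\<not> ?thesis"
    then have "b $ s < d $ s - ereal e" by (simp add: ereal_less_minus)
    then obtain r where r: "b $ s < ereal r" "ereal r < d $ s - ereal e" using ereal_dense2 by blast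
    then have r2: "ereal (r + e) < d $ s" by (cases "d $ s") auto
    define w where "w = (\<chi> i. if i = s then r else u $ i)"
    have "ereal (u $ s) < b $ s" using assms(2) by (simp add: open_rect_def)
    with r have "u $ s < r" by (metis less_ereal.simps(1) less_trans)
    then have "u \<le> w" by (simp add: w_def less_eq_vec_def)
    moreover have "w \<notin> open_rect a b" using r by (auto simp: open_rect_def w_def dest: spec[of _ s])
    moreover have "w + vec e \<in> open_rect c d" using ue r2 \<open>u $ s < r\<close>
      by (auto simp: open_rect_def w_def intro: less_trans[of _ "ereal (u $ s + e)"])
    ultimately show False using nat[of u w x] assms ue zero by simp
  qed
qed

text \<open>Naturality could fail only if one way around a square vanishes and the other does not.
  The lower bounds exclude that \<open>u + vec e\<close> leaves the target while
  \<open>v + vec e\<close> is in it (fact \<open>1\<close>), and the upper bounds exclude that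
  \<open>v\<close> leaves the source (fact \<open>2\<close>).\<close>

lemma morphism_rect_inclusion:
  assumes "\<And>s. c $ s \<le> a $ s + ereal e" "\<And>s. d $ s \<le> b $ s + ereal e"
  shows "morphism (rect_module (open_rect a b) :: ('k::field, 'k, 'n::finite) pmod)
    (shift e (rect_module (open_rect c d)))
    (\<lambda>u x. if u \<in> open_rect a b \<and> u + vec e \<in> open_rect c d then x else 0)"
proof -
  have lo: "c $ s < ereal (u $ s + e)" if "a $ s < ereal (u $ s)" for u :: "real^'n" and s
    using assms(1)[of s] that by (cases "a $ s"; cases "c $ s") auto
  have hi: "ereal (u $ s) < b $ s" if "ereal (u $ s + e) < d $ s" for u :: "real^'n" and s
    using assms(2)[of s] that by (cases "b $ s"; cases "d $ s") auto
  have 1: "u + vec e \<in> open_rect c d" if "u \<in> open_rect a b" "u \<le> v" "v + vec e \<in> open_rect c d" for u v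
  proof -
    have "ereal (u $ s + e) < d $ s" for s
      by (rule le_less_trans[of _ "ereal (v $ s + e)"]) (use that in \<open>auto simp: open_rect_def less_eq_vec_def\<close>)
    then show ?thesis using that(1) lo by (simp add: open_rect_def)
  qed
  have 2: "v \<in> open_rect a b" if "u \<in> open_rect a b" "u \<le> v" "v + vec e \<in> open_rect c d" for u v
  proof -
    have "a $ s < ereal (v $ s)" for s
      by (rule less_le_trans[of _ "ereal (u $ s)"]) (use that in \<open>auto simp: open_rect_def less_eq_vec_def\<close>)
    then show ?thesis using that(3) hi by (simp add: open_rect_def)
  qed
  show ?thesis
    unfolding morphism_def
  proof (intro conjI allI impI ballI)
    fix u v :: "real^'n" and x :: 'k
    assume "u \<le> v" "x \<in> fibre (rect_module (open_rect a b)) u"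
    then show "(if v \<in> open_rect a b \<and> v + vec e \<in> open_rect c d
        then tr (rect_module (open_rect a b)) u v x else 0) =
      tr (shift e (rect_module (open_rect c d))) u v
        (if u \<in> open_rect a b \<and> u + vec e \<in> open_rect c d then x else 0)"
      using 1[of u v] 2[of u v] by (simp split: if_splits)
  qed (simp add: linear_between_def)
qed

text \<open>The two arguments of \<open>min\<close> belong to the two ways of interleaving: by zero
  morphisms, if both modules are \<open>2 * e\<close>-trivial, or by morphisms that are the identity
  wherever source and shifted target are both nonzero.\<close>

lemma interleaved_rect_iff:
  assumes "proper_bounds a b" "proper_bounds c d" "0 \<le> e"
  shows "interleaved e (rect_module (open_rect a b) :: ('k::field, 'k, 'n::finite) pmod)
      (rect_module (open_rect c d) :: ('k, 'k, 'n) pmod) \<longleftrightarrow>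
    min (max (half_width a b) (half_width c d)) (max (sup_norm_diff c a) (sup_norm_diff d b)) \<le> ereal e"
    (is "interleaved e ?R ?Q \<longleftrightarrow> _")
proof
  assume "interleaved e ?R ?Q"
  then obtain f g where f: "morphism ?R (shift e ?Q) f" and g: "morphism ?Q (shift e ?R) g"
    and gf: "\<And>u x. x \<in> fibre ?R u \<Longrightarrow> g (u + vec e) (f u x) = tr ?R u (u + vec (2 * e)) x"
    and fg: "\<And>u x. x \<in> fibre ?Q u \<Longrightarrow> f (u + vec e) (g u x) = tr ?Q u (u + vec (2 * e)) x"
    unfolding interleaved_def by blast
  have fz: "f u 0 = 0" and gz: "g u 0 = 0" for u
    using morphism_zero[OF f] morphism_zero[OF g] by simp_all
  have norms: "max (sup_norm_diff c a) (sup_norm_diff d b) \<le> ereal e"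
    if "\<exists>u x. u \<in> open_rect a b \<and> f u x \<noteq> 0" "\<exists>u x. u \<in> open_rect c d \<and> g u x \<noteq> 0"
    using that morphism_rect_imp_le[OF f] morphism_rect_imp_le[OF g] \<open>0 \<le> e\<close>
    by (auto simp: sup_norm_diff_le_iff)
  have "max (sup_norm_diff c a) (sup_norm_diff d b) \<le> ereal e" if wide: "\<not> half_width a b \<le> ereal e"
  proof -
    obtain u where u: "u \<in> open_rect a b" "u + vec (2 * e) \<in> open_rect a b"
      using wide half_width_le_iff[OF assms(1,3)] by blast
    \<comment> \<open>A nonzero composite makes \<open>f\<close> and \<open>g\<close> nonzero at
      once, so one wide rectangle already yields the corner inequalities in both directions.\<close>
    then have "g (u + vec e) (f u 1) = 1" using gf[of 1 u] by simp
    then have "g (u + vec e) (f u 1) \<noteq> 0" by simp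
    moreover from this have "f u 1 \<noteq> 0" using gz by metis
    moreover from this have "u + vec e \<in> open_rect c d"
      using morphism_rect_eq_0[OF f, of 1 u] u by auto
    ultimately have "f u 1 \<noteq> 0" "u + vec e \<in> open_rect c d" "g (u + vec e) (f u 1) \<noteq> 0" by blast+
    with u show ?thesis by (intro norms) blast+
  qed
  moreover have "max (sup_norm_diff c a) (sup_norm_diff d b) \<le> ereal e" if wide: "\<not> half_width c d \<le> ereal e"
  proof -
    obtain u where u: "u \<in> open_rect c d" "u + vec (2 * e) \<in> open_rect c d"
      using wide half_width_le_iff[OF assms(2,3)] by blast
    then have "f (u + vec e) (g u 1) = 1" using fg[of 1 u] by simp
    then have "f (u + vec e) (g u 1) \<noteq> 0" by simp
    moreover from this have "g u 1 \<noteq> 0" using fz by metis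
    moreover from this have "u + vec e \<in> open_rect a b"
      using morphism_rect_eq_0[OF g, of 1 u] u by auto
    ultimately have "g u 1 \<noteq> 0" "u + vec e \<in> open_rect a b" "f (u + vec e) (g u 1) \<noteq> 0" by blast+
    with u show ?thesis by (intro norms) blast+
  qed
  ultimately show "min (max (half_width a b) (half_width c d)) (max (sup_norm_diff c a) (sup_norm_diff d b)) \<le> ereal e"
    by (simp only: min_le_iff_disj max.bounded_iff) blast
next
  have dbl: "u + vec e + vec e = u + vec (2 * e)" for u :: "real^'n" by (simp add: vec_eq_iff)
  assume "min (max (half_width a b) (half_width c d)) (max (sup_norm_diff c a) (sup_norm_diff d b)) \<le> ereal e"
  then consider "half_width a b \<le> ereal e" "half_width c d \<le> ereal e"
    | "sup_norm_diff c a \<le> ereal e" "sup_norm_diff d b \<le> ereal e"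
    by (auto simp: min_le_iff_disj)
  then show "interleaved e ?R ?Q"
  proof cases
    case 1
    then show ?thesis
      unfolding interleaved_def half_width_le_iff[OF assms(1,3)] half_width_le_iff[OF assms(2,3)]
      by (intro exI[of _ "\<lambda>_ _. 0"]) (auto simp: morphism_def linear_between_def)
  next
    case 2
    then have le: "c $ s \<le> a $ s + ereal e" "a $ s \<le> c $ s + ereal e"
      "d $ s \<le> b $ s + ereal e" "b $ s \<le> d $ s + ereal e" for s
      using \<open>0 \<le> e\<close> by (auto simp: sup_norm_diff_le_iff)
    \<comment> \<open>The composite of the two identity-like morphisms is nonzero only if the
      intermediate point lies in the other rectangle. This shows that it does whenever the
      transition map by \<open>2 * e\<close> is nonzero. The bounds are generic here so that the
      fact serves both composites.\<close>
    have mid: "u + vec e \<in> open_rect c d" if "u \<in> open_rect a b" "u + vec (2*e) \<in> open_rect a b"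
        "\<And>s. c $ s \<le> a $ s + ereal e" "\<And>s. b $ s \<le> d $ s + ereal e" for u and a b c d :: "ereal^'n"
    proof -
      have "c $ s < ereal (u $ s + e) \<and> ereal (u $ s + e) < d $ s" for s
        using that(3,4)[of s] spec[OF that(1)[unfolded open_rect_def, simplified], of s]
          spec[OF that(2)[unfolded open_rect_def, simplified], of s]
        by (cases "a $ s"; cases "c $ s"; cases "b $ s"; cases "d $ s") auto
      then show ?thesis by (simp add: open_rect_def)
    qed
    show ?thesis unfolding interleaved_def
      using morphism_rect_inclusion[of c a e d b, OF le(1,3)] morphism_rect_inclusion[of a c e b d, OF le(2,4)]
        mid[of _ a b c d] mid[of _ c d a b] le
      by (intro exI conjI) (assumption | auto simp: dbl)+
  qed
qed

text \<open>This turns an equivalence with \<open>t \<le> ereal e\<close> for real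
  \<open>e \<ge> 0\<close> into the value of a distance. For infinite \<open>t\<close> no real
  \<open>e\<close> qualifies, and the infimum of the empty set is again infinite.\<close>

lemma Inf_ereal_ge:
  assumes "0 \<le> t"
  shows "Inf {ereal e | e. 0 \<le> e \<and> t \<le> ereal e} = t"
  using assms
proof (cases t)
  case (real r)
  then show ?thesis using assms by (intro Inf_eqI) auto
next
  case PInf
  then have "{ereal e | e. 0 \<le> e \<and> t \<le> ereal e} = {}" by auto
  then show ?thesis using PInf by (simp add: top_ereal_def)
qed auto

lemma interleaving_dist_rect:
  assumes "proper_bounds a b" "proper_bounds c d"
  shows "interleaving_dist (rect_module (open_rect a b) :: ('k::field, 'k, 'n::finite) pmod)
      (rect_module (open_rect c d) :: ('k, 'k, 'n) pmod) =
    min (max (half_width a b) (half_width c d)) (max (sup_norm_diff c a) (sup_norm_diff d b))"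
proof -
  let ?t = "min (max (half_width a b) (half_width c d)) (max (sup_norm_diff c a) (sup_norm_diff d b))"
  have "{ereal e | e. 0 \<le> e \<and> interleaved e (rect_module (open_rect a b) :: ('k, 'k, 'n) pmod)
      (rect_module (open_rect c d) :: ('k, 'k, 'n) pmod)} = {ereal e | e. 0 \<le> e \<and> ?t \<le> ereal e}"
    using interleaved_rect_iff[OF assms] by blast
  moreover have "0 \<le> ?t"
    using half_width_nonneg[OF assms(1)] sup_norm_diff_nonneg[of c a] by (simp add: le_max_iff_disj)
  ultimately show ?thesis unfolding interleaving_dist_def by (simp only: Inf_ereal_ge)
qed

section \<open>Uniqueness of the barcode\<close>

lemma isomorphic_sym: "isomorphic M N \<Longrightarrow> isomorphic N M"
  unfolding isomorphic_def by blast

lemma morphism_comp: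
  assumes "morphism M N f" "morphism N P g"
  shows "morphism M P (\<lambda>u x. g u (f u x))"
  using assms unfolding morphism_def linear_between_def by simp

lemma isomorphic_trans:
  assumes "isomorphic M N" "isomorphic N P"
  shows "isomorphic M P"
proof -
  obtain f f' where f: "morphism M N f" "morphism N M f'"
    "\<And>u x. x \<in> fibre M u \<Longrightarrow> f' u (f u x) = x" "\<And>u y. y \<in> fibre N u \<Longrightarrow> f u (f' u y) = y"
    using assms(1) unfolding isomorphic_def by blast
  obtain g g' where g: "morphism N P g" "morphism P N g'"
    "\<And>u x. x \<in> fibre N u \<Longrightarrow> g' u (g u x) = x" "\<And>u y. y \<in> fibre P u \<Longrightarrow> g u (g' u y) = y"
    using assms(2) unfolding isomorphic_def by blast
  have "\<And>u x. x \<in> fibre M u \<Longrightarrow> f u x \<in> fibre N u" "\<And>u y. y \<in> fibre P u \<Longrightarrow> g' u y \<in> fibre N u"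
    using f(1) g(2) unfolding morphism_def linear_between_def by blast+
  then show ?thesis
    unfolding isomorphic_def
    using morphism_comp[OF f(1) g(1)] morphism_comp[OF g(2) f(2)] f(3,4) g(3,4)
    by (intro exI conjI) (assumption | simp)+
qed

section \<open>Ranks of transition maps in finite sums of rectangle modules\<close>

abbreviation (input) rect_sum :: "'i set \<Rightarrow> ('i \<Rightarrow> (real^'n::finite) set) \<Rightarrow> ('k::field, 'i \<Rightarrow> 'k, 'n) pmod" where
  "rect_sum I R \<equiv> direct_sum I (\<lambda>i. rect_module (R i))"

lemma direct_sum_simps:
  "scl (direct_sum I X) = (\<lambda>r f i. scl (X i) r (f i))"
  "x \<in> fibre (direct_sum I X) u \<longleftrightarrow>
    finite {i. x i \<noteq> 0} \<and> (\<forall>i\<in>I. x i \<in> fibre (X i) u) \<and> (\<forall>i. i \<notin> I \<longrightarrow> x i = 0)"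
  "tr (direct_sum I X) u v x = (\<lambda>i. if i \<in> I then tr (X i) u v (x i) else 0)"
  by (simp_all add: direct_sum_def)

lemma rect_sum_reindex:
  assumes h: "bij_betw h I J" and fin: "finite I" and RQ: "\<And>i. i \<in> I \<Longrightarrow> R i = Q (h i)"
  shows "isomorphic (rect_sum I R :: ('k::field, 'i \<Rightarrow> 'k, 'n::finite) pmod)
    (rect_sum J Q :: ('k, 'j \<Rightarrow> 'k, 'n) pmod)"
proof -
  define h' where "h' = inv_into I h"
  have h': "h' j \<in> I" "h (h' j) = j" if "j \<in> J" for j
    using h that unfolding h'_def bij_betw_def by (auto intro: inv_into_into f_inv_into_f)
  have hI: "h i \<in> J" "h' (h i) = i" if "i \<in> I" for i
    using h that unfolding h'_def bij_betw_def by auto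
  have finJ: "finite J" using h fin bij_betw_finite by blast
  have f1: "finite {i. (if i \<in> I then x i else 0) \<noteq> 0}" for x :: "'i \<Rightarrow> 'k"
    by (rule finite_subset[OF _ fin]) auto
  have f2: "finite {j. (if j \<in> J then x j else 0) \<noteq> 0}" for x :: "'j \<Rightarrow> 'k"
    by (rule finite_subset[OF _ finJ]) auto
  have RQ': "R (h' j) = Q j" if "j \<in> J" for j using RQ h'[OF that] by simp
  have m1: "morphism (rect_sum I R) (rect_sum J Q) (\<lambda>u (x :: 'i \<Rightarrow> 'k) j. if j \<in> J then x (h' j) else 0)"
    unfolding morphism_def linear_between_def
    by (auto simp: direct_sum_simps fun_eq_iff f1 f2 RQ'[symmetric] h' hI simp del: rect_module_simps(2))
  have m2: "morphism (rect_sum J Q) (rect_sum I R) (\<lambda>u (y :: 'j \<Rightarrow> 'k) i. if i \<in> I then y (h i) else 0)"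
    unfolding morphism_def linear_between_def
    by (auto simp: direct_sum_simps fun_eq_iff f1 f2 RQ h' hI simp del: rect_module_simps(2))
  show ?thesis unfolding isomorphic_def
    by (intro exI conjI, rule m1, rule m2) (auto simp: direct_sum_simps fun_eq_iff h' hI)
qed

text \<open>The vectors supported on \<open>A\<close> form a space \<open>T\<close> of dimension
  \<open>card A\<close> that the transition map from \<open>u\<close> to \<open>v\<close> fixes
  pointwise. By naturality \<open>f v\<close> sends \<open>T\<close> into the image of the
  transition map of \<open>?Y\<close>, whose elements are supported on \<open>B\<close>. Since
  \<open>f v\<close> is injective on \<open>T\<close>, comparing dimensions gives the bound.\<close>

lemma rect_sum_rank_le:
  assumes iso: "isomorphic (rect_sum I R :: ('k::field, 'i \<Rightarrow> 'k, 'n::finite) pmod)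
      (rect_sum J Q :: ('k, 'j \<Rightarrow> 'k, 'n) pmod)"
    and fin: "finite I" "finite J" and uv: "u \<le> v"
  shows "card {i \<in> I. u \<in> R i \<and> v \<in> R i} \<le> card {j \<in> J. u \<in> Q j \<and> v \<in> Q j}"
proof -
  let ?X = "rect_sum I R :: ('k, 'i \<Rightarrow> 'k, 'n) pmod" and ?Y = "rect_sum J Q :: ('k, 'j \<Rightarrow> 'k, 'n) pmod"
  define A B where "A = {i \<in> I. u \<in> R i \<and> v \<in> R i}" and "B = {j \<in> J. u \<in> Q j \<and> v \<in> Q j}"
  have finAB: "finite A" "finite B" using fin by (simp_all add: A_def B_def)
  define T :: "('i \<Rightarrow> 'k) set" where "T = {x. \<forall>i. i \<notin> A \<longrightarrow> x i = 0}"
  have supp: "finite {i. x i \<noteq> 0}" if "x \<in> T" for x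
    using that by (intro finite_subset[OF _ finAB(1)]) (auto simp: T_def)
  have Tu: "x \<in> fibre ?X u" "x \<in> fibre ?X v" "tr ?X u v x = x" if "x \<in> T" for x
  proof -
    have x: "x i = 0" if "\<not> (i \<in> I \<and> u \<in> R i \<and> v \<in> R i)" for i
      using \<open>x \<in> T\<close> that by (simp add: T_def A_def)
    show "x \<in> fibre ?X u" "x \<in> fibre ?X v"
      unfolding direct_sum_simps(2) using supp[OF that] x by simp_all
    show "tr ?X u v x = x"
      unfolding direct_sum_simps(3) using x by (auto simp: fun_eq_iff)
  qed
  obtain f g where f: "morphism ?X ?Y f" and gf: "\<And>u x. x \<in> fibre ?X u \<Longrightarrow> g u (f u x) = x"
    using iso unfolding isomorphic_def by blast
  have inj: "inj_on (f v) T"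
    using gf Tu(2) by (intro inj_on_inverseI[where g = "g v"]) blast
  have T_add: "x + y \<in> T" if "x \<in> T" "y \<in> T" for x y
    using that by (auto simp: T_def)
  have T_scale: "(\<lambda>i. r * x i) \<in> T" if "x \<in> T" for x r
    using that by (auto simp: T_def)
  have f_add: "f v (x + y) = f v x + f v y" if "x \<in> T" "y \<in> T" for x y
    using f Tu(2)[OF that(1)] Tu(2)[OF that(2)] unfolding morphism_def linear_between_def by blast
  have f_scale: "f v (\<lambda>i. r * x i) = (\<lambda>j. r * f v x j)" if "x \<in> T" for x r
  proof -
    have "f v (scl ?X r x) = scl ?Y r (f v x)"
      using f Tu(2)[OF that] unfolding morphism_def linear_between_def by blast
    then show ?thesis by (simp only: direct_sum_simps(1) rect_module_simps(1))
  qed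
  \<comment> \<open>As \<open>x\<close> is its own image under the transition map,
    \<open>f v x\<close> is the image of \<open>f u x\<close> in \<open>?Y\<close>; coordinates
    outside \<open>B\<close> do not survive that map.\<close>
  have f_supp: "f v x j = 0" if "x \<in> T" "j \<notin> B" for x j
  proof -
    have "f v (tr ?X u v x) = tr ?Y u v (f u x)"
      using f Tu(1)[OF that(1)] uv unfolding morphism_def by blast
    then have "f v x = tr ?Y u v (f u x)" by (simp only: Tu(3)[OF that(1)])
    then show ?thesis using that(2) by (auto simp: direct_sum_simps B_def)
  qed
  have T0: "0 \<in> T" by (simp add: T_def)
  have f_0: "f v 0 = 0" using f_add[OF T0 T0] by simp
  \<comment> \<open>The dimension count takes place in the space of all functions on
    \<open>'j\<close>, which contains the fibres of \<open>?Y\<close>.\<close>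
  interpret V: vector_space "\<lambda>(r::'k) x (j::'j). r * x j"
    by unfold_locales (auto simp: fun_eq_iff algebra_simps)
  define e :: "'i \<Rightarrow> 'i \<Rightarrow> 'k" where "e = (\<lambda>i i'. if i' = i then 1 else 0)"
  define e' :: "'j \<Rightarrow> 'j \<Rightarrow> 'k" where "e' = (\<lambda>j j'. if j' = j then 1 else 0)"
  have eT: "e i \<in> T" if "i \<in> A" for i using that by (auto simp: e_def T_def)
  have inj_e: "inj_on e A" by (rule inj_onI) (metis e_def one_neq_zero)
  \<comment> \<open>Additivity and homogeneity of \<open>f v\<close> are available only on
    \<open>T\<close>, so the induction also carries the membership of the partial sums in
    \<open>T\<close>.\<close>
  have f_sum: "f v (\<lambda>i'. \<Sum>i\<in>C. r i * e i i') = (\<Sum>i\<in>C. (\<lambda>j. r i * f v (e i) j)) \<and>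
      (\<lambda>i'. \<Sum>i\<in>C. r i * e i i') \<in> T" if "C \<subseteq> A" for r C
    using finite_subset[OF that finAB(1)] that
  proof (induction C)
    case empty
    then show ?case using f_0 T0 by (simp add: zero_fun_def)
  next
    case (insert i C)
    have eq: "(\<lambda>i'. \<Sum>i\<in>insert i C. r i * e i i') = (\<lambda>i'. r i * e i i') + (\<lambda>i'. \<Sum>i\<in>C. r i * e i i')"
      using insert by (simp add: fun_eq_iff)
    have mem: "(\<lambda>i'. \<Sum>i\<in>C. r i * e i i') \<in> T" "e i \<in> T" using insert eT by auto
    show ?case unfolding eq
      using insert f_add[OF T_scale[OF mem(2)] mem(1), of "r i"] f_scale[OF mem(2)]
        T_add[OF T_scale[OF mem(2)] mem(1), of "r i"] by simp
  qed
  have "V.independent ((\<lambda>i. f v (e i)) ` A)"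
  proof (rule V.independent_if_scalars_zero)
    fix r :: "('j \<Rightarrow> 'k) \<Rightarrow> 'k" and y
    assume sum: "(\<Sum>y\<in>(\<lambda>i. f v (e i)) ` A. (\<lambda>j. r y * y j)) = 0" and y: "y \<in> (\<lambda>i. f v (e i)) ` A"
    have inj': "inj_on (\<lambda>i. f v (e i)) A"
      using inj_e inj eT by (auto simp: inj_on_def)
    let ?s = "\<lambda>i. r (f v (e i))"
    have "f v (\<lambda>i'. \<Sum>i\<in>A. ?s i * e i i') = f v 0"
      using sum f_sum[OF order_refl, of ?s] by (simp add: sum.reindex[OF inj'] f_0)
    then have "(\<lambda>i'. \<Sum>i\<in>A. ?s i * e i i') = 0"
      using inj f_sum[OF order_refl, of ?s] T0 by (auto dest: inj_onD)
    moreover have "(\<Sum>i\<in>A. ?s i * e i i') = ?s i'" if "i' \<in> A" for i'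
      using that finAB by (simp add: e_def if_distrib cong: if_cong)
    ultimately have "?s i = 0" if "i \<in> A" for i
      using that by (metis zero_fun_apply)
    then show "r y = 0" using y by blast
  qed (use finAB in simp)
  moreover have "(\<lambda>i. f v (e i)) ` A \<subseteq> V.span (e' ` B)"
  proof
    fix y assume "y \<in> (\<lambda>i. f v (e i)) ` A"
    then have "y j = 0" if "j \<notin> B" for j using f_supp eT that by blast
    moreover have "(\<Sum>j\<in>C. (\<lambda>j'. y j * e' j j')) j'' = (\<Sum>j\<in>C. y j * e' j j'')" for C j''
      by (induction C rule: infinite_finite_induct) auto
    ultimately have "y = (\<Sum>j\<in>B. (\<lambda>j'. y j * e' j j'))"
      using finAB by (auto simp: fun_eq_iff e'_def if_distrib cong: if_cong)
    also have "\<dots> \<in> V.span (e' ` B)"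
      by (intro V.span_sum V.span_scale V.span_base) auto
    finally show "y \<in> V.span (e' ` B)" .
  qed
  ultimately have "card ((\<lambda>i. f v (e i)) ` A) \<le> card (e' ` B)"
    using V.independent_span_bound finAB by blast
  moreover have "card ((\<lambda>i. f v (e i)) ` A) = card A"
    using inj_e inj eT by (intro card_image) (auto simp: inj_on_def)
  moreover have "card (e' ` B) \<le> card B" using finAB card_image_le by blast
  ultimately show ?thesis by (simp add: A_def B_def)
qed

lemma rect_sum_rank_eq:
  assumes "isomorphic (rect_sum I R :: ('k::field, 'i \<Rightarrow> 'k, 'n::finite) pmod)
      (rect_sum J Q :: ('k, 'j \<Rightarrow> 'k, 'n) pmod)"
    and "finite I" "finite J" "u \<le> v"
  shows "card {i \<in> I. u \<in> R i \<and> v \<in> R i} = card {j \<in> J. u \<in> Q j \<and> v \<in> Q j}"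
  using rect_sum_rank_le[OF assms] rect_sum_rank_le[OF isomorphic_sym[OF assms(1)] assms(3,2,4)] by simp

section \<open>Multisets as families of numbered copies\<close>

lemma instances_insert:
  "instances (add_mset x B) = insert (x, count B x) (instances B)"
  by (auto simp: instances_def split: if_splits)

lemma instances_empty: "instances {#} = {}" by (simp add: instances_def)

lemma finite_instances: "finite (instances B)"
  by (induction B) (simp_all add: instances_insert instances_empty)

lemma card_instances_filter: "card {p \<in> instances B. P (fst p)} = size (filter_mset P B)"
proof (induction B)
  case (add x B)
  have "{p \<in> instances (add_mset x B). P (fst p)} =
      (if P x then {(x, count B x)} else {}) \<union> {p \<in> instances B. P (fst p)}"
    by (auto simp: instances_insert)
  moreover have "(x, count B x) \<notin> instances B" by (simp add: instances_def)
  ultimately show ?case using add finite_instances[of B] by simp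
qed (simp add: instances_empty)

text \<open>This links an arbitrary finite indexing to the canonical one used for barcodes. Copies
  are numbered from \<open>0\<close>, so a newly added \<open>i\<close> receives the old
  multiplicity of \<open>R i\<close> as its number.\<close>

lemma ex_bij_instances:
  assumes "finite I"
  shows "\<exists>h. bij_betw h I (instances (image_mset R (mset_set I))) \<and> (\<forall>i\<in>I. fst (h i) = R i)"
  using assms
proof (induction I)
  case (insert i I)
  let ?B = "image_mset R (mset_set I)"
  obtain h where h: "bij_betw h I (instances ?B)" "\<forall>i\<in>I. fst (h i) = R i" using insert by blast
  have "bij_betw (h(i := (R i, count ?B (R i)))) (insert i I) (insert (R i, count ?B (R i)) (instances ?B))"
  proof -
    have "bij_betw (h(i := (R i, count ?B (R i)))) I (instances ?B)"
      using h(1) insert(2) by (subst bij_betw_cong[where g = h]) auto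
    moreover have "(R i, count ?B (R i)) \<notin> instances ?B" by (simp add: instances_def)
    ultimately show ?thesis
      using notIn_Un_bij_betw[of i I "h(i := (R i, count ?B (R i)))" "instances ?B"] insert(2) by simp
  qed
  then show ?case using h(2) insert(1,2)
    by (intro exI[of _ "h(i := (R i, count ?B (R i)))"]) (auto simp: instances_insert simp del: fun_upd_apply, auto)
qed (simp add: instances_empty bij_betw_def)

section \<open>Rectangles as order-convex sublattices\<close>

lemma rectangleE:
  fixes R :: "(real^'n::finite) set"
  assumes "rectangle R"
  obtains J where "\<And>s. is_interval (J s)" "\<And>s. J s \<noteq> {}" "\<And>u. u \<in> R \<longleftrightarrow> (\<forall>s. u $ s \<in> J s)"
proof -
  from assms obtain J :: "'n \<Rightarrow> real set"
    where "\<forall>s. is_interval (J s) \<and> J s \<noteq> {}" "R = {u. \<forall>s. u $ s \<in> J s}"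
    unfolding rectangle_def by (elim exE conjE)
  then show thesis using that[of J] by simp
qed

lemma rectangle_inf_sup:
  fixes R :: "(real^'n::finite) set"
  assumes "rectangle R" "u \<in> R" "v \<in> R"
  shows "(\<chi> s. min (u $ s) (v $ s)) \<in> R" "(\<chi> s. max (u $ s) (v $ s)) \<in> R"
proof -
  obtain J where R: "\<And>u. u \<in> R \<longleftrightarrow> (\<forall>s. u $ s \<in> J s)"
    using assms(1) by (elim rectangleE) (rule that)
  show "(\<chi> s. min (u $ s) (v $ s)) \<in> R" "(\<chi> s. max (u $ s) (v $ s)) \<in> R"
    using assms(2,3) by (simp_all add: R min_def max_def)
qed

lemma rectangle_between:
  fixes R :: "(real^'n::finite) set"
  assumes "rectangle R" "u \<in> R" "v \<in> R" "u \<le> w" "w \<le> v"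
  shows "w \<in> R"
proof -
  obtain J where J: "\<And>s. is_interval (J s)" and R: "\<And>u. u \<in> R \<longleftrightarrow> (\<forall>s. u $ s \<in> J s)"
    using assms(1) by (elim rectangleE) (rule that)
  have "w $ s \<in> J s" for s
  proof (rule mem_is_interval_1_I[OF J])
    show "u $ s \<in> J s" "v $ s \<in> J s" using assms(2,3) by (simp_all add: R)
    show "u $ s \<le> w $ s" "w $ s \<le> v $ s" using assms(4,5) by (simp_all add: less_eq_vec_def)
  qed
  then show ?thesis by (simp add: R)
qed

lemma rectangle_nonempty:
  assumes "rectangle R"
  shows "R \<noteq> {}"
proof -
  obtain J where J: "\<And>s. J s \<noteq> {}" and R: "\<And>u. u \<in> R \<longleftrightarrow> (\<forall>s. u $ s \<in> J s)"
    using assms by (elim rectangleE) (rule that)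
  have "(\<chi> s. SOME x. x \<in> J s) \<in> R" using J by (simp add: R some_in_eq)
  then show ?thesis by blast
qed

text \<open>Coordinatewise minima and maxima stay in \<open>R\<close>, so the box can be enlarged
  one point at a time. With no points given, any element of \<open>R\<close> serves as both corners;
  this covers the comparison with an empty barcode.\<close>

lemma rectangle_finite_bounds:
  assumes "rectangle R" "finite P" "P \<subseteq> R"
  shows "\<exists>u v. u \<in> R \<and> v \<in> R \<and> u \<le> v \<and> (\<forall>p\<in>P. u \<le> p \<and> p \<le> v)"
  using assms(2,3)
proof (induction P)
  case empty
  then show ?case using rectangle_nonempty[OF assms(1)] by blast
next
  case (insert p P)
  then obtain u v where uv: "u \<in> R" "v \<in> R" "u \<le> v" "\<forall>p\<in>P. u \<le> p \<and> p \<le> v" by auto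
  let ?u = "\<chi> s. min (u $ s) (p $ s)" and ?v = "\<chi> s. max (v $ s) (p $ s)"
  have "?u \<in> R" "?v \<in> R" using rectangle_inf_sup[OF assms(1)] uv insert by auto
  moreover have "?u \<le> u" "v \<le> ?v" "?u \<le> p" "p \<le> ?v" by (simp_all add: less_eq_vec_def)
  ultimately show ?case using uv by (intro exI[of _ ?u] exI[of _ ?v]) (auto intro: order_trans)
qed

lemma maximal_rect_not_in_one:
  assumes rect: "\<And>R. R \<in># B \<Longrightarrow> rectangle R" "\<And>R. R \<in># B' \<Longrightarrow> rectangle R"
    and rank: "\<And>u v. u \<le> v \<Longrightarrow> size {#R \<in># B. u \<in> R \<and> v \<in> R#} = size {#R \<in># B'. u \<in> R \<and> v \<in> R#}"
    and disj: "R \<notin># B'" "R \<in># B" "\<And>S. S \<in># B' \<Longrightarrow> \<not> R \<subset> S"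
  shows False
proof -
  have "\<exists>p. p \<in> R - S" if "S \<in># B'" for S
  proof -
    have "S \<noteq> R" using disj(1) that by blast
    then show ?thesis using disj(3)[of S] that by auto
  qed
  then obtain p where p: "\<And>S. S \<in># B' \<Longrightarrow> p S \<in> R - S" by metis
  obtain u v where uv: "u \<in> R" "v \<in> R" "u \<le> v" "\<And>S. S \<in># B' \<Longrightarrow> u \<le> p S \<and> p S \<le> v"
    using rectangle_finite_bounds[OF rect(1)[OF disj(2)], of "p ` set_mset B'"] p by fastforce
  \<comment> \<open>By order convexity, a rectangle \<open>S\<close> containing both corners would
    contain \<open>p S\<close>, which lies between them.\<close>
  have "\<not> (u \<in> S \<and> v \<in> S)" if "S \<in># B'" for S
    using rectangle_between[OF rect(2)[OF that]] uv(4)[OF that] p[OF that] by blast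
  then have "{#R \<in># B'. u \<in> R \<and> v \<in> R#} = {#}" by auto
  then have "{#R \<in># B. u \<in> R \<and> v \<in> R#} = {#}"
    using rank[OF uv(3)] by (simp only: size_empty size_eq_0_iff_empty)
  then show False using uv disj(2) by auto
qed

lemma rect_multiset_eqI:
  assumes rect: "\<And>R. R \<in># B \<Longrightarrow> rectangle R" "\<And>R. R \<in># B' \<Longrightarrow> rectangle R"
    and rank: "\<And>u v. u \<le> v \<Longrightarrow> size {#R \<in># B. u \<in> R \<and> v \<in> R#} = size {#R \<in># B'. u \<in> R \<and> v \<in> R#}"
  shows "B = B'"
proof (rule ccontr)
  assume ne: "B \<noteq> B'"
  \<comment> \<open>Ranks add up over multisets, so the common part cancels, and no rectangle
    remains on both sides.\<close>
  define C D where "C = B - B'" and "D = B' - B"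
  have CD: "B = (B \<inter># B') + C" "B' = (B \<inter># B') + D" "\<And>R. \<not> (R \<in># C \<and> R \<in># D)"
    unfolding C_def D_def by (auto simp: multiset_eq_iff in_diff_count)
  have rank': "size {#R \<in># C. u \<in> R \<and> v \<in> R#} = size {#R \<in># D. u \<in> R \<and> v \<in> R#}" if "u \<le> v" for u v
    using rank[OF that] by (subst (asm) CD(1), subst (asm) CD(2)) simp
  have rect': "\<And>R. R \<in># C \<Longrightarrow> rectangle R" "\<And>R. R \<in># D \<Longrightarrow> rectangle R"
    unfolding C_def D_def using rect by (auto dest: in_diffD)
  have "set_mset (C + D) \<noteq> {}" using ne CD by auto
  \<comment> \<open>Maximality is taken over both remainders together: wherever \<open>R\<close>
    comes from, no rectangle of the opposite side properly contains it.\<close>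
  then obtain R where R: "R \<in># C + D" "\<And>S. S \<in># C + D \<Longrightarrow> \<not> R \<subset> S"
    using finite_has_maximal[of "set_mset (C + D)"] by (metis finite_set_mset psubset_eq)
  then have max: "\<And>S. S \<in># C \<Longrightarrow> \<not> R \<subset> S" "\<And>S. S \<in># D \<Longrightarrow> \<not> R \<subset> S" by auto
  from R(1) consider "R \<in># C" | "R \<in># D" by auto
  then show False
  proof cases
    case 1
    then show False
      using maximal_rect_not_in_one[OF rect' rank' _ _ max(2)] CD(3) by blast
  next
    case 2
    then show False
      using maximal_rect_not_in_one[OF rect'(2,1) rank'[symmetric] _ _ max(1)] CD(3) by blast
  qed
qed

lemma is_barcode_unique:
  assumes "is_barcode M B" "is_barcode M B'"
  shows "B = B'"
proof (rule rect_multiset_eqI)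
  fix u v :: "real^'c" assume "u \<le> v"
  then show "size {#R \<in># B. u \<in> R \<and> v \<in> R#} = size {#R \<in># B'. u \<in> R \<and> v \<in> R#}"
    using assms rect_sum_rank_eq[OF isomorphic_trans[OF isomorphic_sym] finite_instances finite_instances,
        of M B fst B' fst u v]
    unfolding is_barcode_def card_instances_filter[symmetric] by blast
qed (use assms in \<open>auto simp: is_barcode_def\<close>)

text \<open>By uniqueness, the definite description in \<open>barcode\<close> can be evaluated from
  any finite decomposition into rectangle modules.\<close>

lemma barcode_eq:
  fixes M :: "('k::field, 'v::ab_group_add, 'n::finite) pmod"
  assumes "isomorphic M (rect_sum I R)" "finite I" "\<And>i. i \<in> I \<Longrightarrow> rectangle (R i)"
  shows "barcode M = image_mset R (mset_set I)"
proof -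
  let ?B = "image_mset R (mset_set I)"
  obtain h where h: "bij_betw h I (instances ?B)" "\<And>i. i \<in> I \<Longrightarrow> R i = fst (h i)"
    using ex_bij_instances[OF assms(2)] by metis
  have "isomorphic M (rect_sum (instances ?B) fst :: ('k, (real^'n) set \<times> nat \<Rightarrow> 'k, 'n) pmod)"
    by (rule isomorphic_trans[OF assms(1)], rule rect_sum_reindex[OF h(1) assms(2)], rule h(2))
  then have "is_barcode M ?B"
    unfolding is_barcode_def using assms(2,3) by simp
  then show ?thesis unfolding barcode_def using is_barcode_unique by blast
qed

lemma rectangle_open_rect:
  assumes "proper_bounds a b"
  shows "rectangle (open_rect a b)"
  unfolding rectangle_def
proof (intro exI[of _ "\<lambda>s. {x. a $ s < ereal x \<and> ereal x < b $ s}"] conjI allI)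
  fix s
  show "is_interval {x. a $ s < ereal x \<and> ereal x < b $ s}"
    unfolding is_interval_1
  proof (intro ballI allI impI, elim conjE, intro CollectI conjI)
    fix x y z :: real
    assume "x \<in> {x. a $ s < ereal x \<and> ereal x < b $ s}" "y \<in> {x. a $ s < ereal x \<and> ereal x < b $ s}"
      and "x \<le> z" "z \<le> y"
    then have "a $ s < ereal x" "ereal x \<le> ereal z" "ereal z \<le> ereal y" "ereal y < b $ s" by auto
    then show "a $ s < ereal z" "ereal z < b $ s" using less_le_trans le_less_trans by blast+
  qed
  show "{x. a $ s < ereal x \<and> ereal x < b $ s} \<noteq> {}"
    using assms ereal_dense2[of "a $ s" "b $ s"] by (auto simp: proper_bounds_def)
qed (auto simp: open_rect_def)

section \<open>The bottleneck distance\<close>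

lemma finite_partial_multibijections:
  assumes "finite I" "finite J"
  shows "finite (partial_multibijections I J)"
proof (rule finite_subset)
  show "partial_multibijections I J \<subseteq> (\<Union>A\<in>Pow I. {\<sigma>. dom \<sigma> = A \<and> ran \<sigma> \<subseteq> J})"
    by (auto simp: partial_multibijections_def)
  show "finite (\<Union>A\<in>Pow I. {\<sigma>. dom \<sigma> = A \<and> ran \<sigma> \<subseteq> J})"
    using assms by (intro finite_UN_I) (auto intro: finite_set_of_finite_maps finite_subset)
qed

text \<open>The bottleneck distance matches numbered copies of rectangles, whereas decompositions
  come with their own index sets. A matching is transported as \<open>g\<close> after \<sigma> after
  the inverse of \<open>h\<close>; using the inverse bijections gives the other direction.\<close>

lemma eps_matching_reindex:
  assumes h: "bij_betw h I I'" and g: "bij_betw g J J'"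
    and X: "\<And>i. i \<in> I \<Longrightarrow> X i = X' (h i)" and Y: "\<And>j. j \<in> J \<Longrightarrow> Y j = Y' (g j)"
    and \<sigma>: "eps_matching e I X J Y \<sigma>"
  shows "\<exists>\<sigma>'. eps_matching e I' X' J' Y' \<sigma>'"
proof -
  define h' where "h' = inv_into I h"
  have h': "h' p \<in> I" "h (h' p) = p" if "p \<in> I'" for p
    using h that unfolding h'_def bij_betw_def by (auto intro: inv_into_into f_inv_into_f)
  have hI: "h i \<in> I'" "h' (h i) = i" if "i \<in> I" for i
    using h that unfolding h'_def bij_betw_def by auto
  have gJ: "g j \<in> J'" if "j \<in> J" for j using g that unfolding bij_betw_def by auto
  have g_inj: "inj_on g J" and g_surj: "J' = g ` J" using g by (auto simp: bij_betw_def)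
  define \<sigma>' where "\<sigma>' = (\<lambda>p. if p \<in> I' then map_option g (\<sigma> (h' p)) else None)"
  have \<sigma>_pm: "dom \<sigma> \<subseteq> I" "ran \<sigma> \<subseteq> J" "inj_on \<sigma> (dom \<sigma>)"
    using \<sigma> by (auto simp: eps_matching_def partial_multibijections_def)
  \<comment> \<open>Describing the graph of the transported matching without \<open>h'\<close> makes
    its domain and range plain images.\<close>
  have \<sigma>'_iff: "\<sigma>' p = Some q \<longleftrightarrow> (\<exists>i j. p = h i \<and> q = g j \<and> \<sigma> i = Some j)" for p q
  proof
    assume "\<sigma>' p = Some q"
    then show "\<exists>i j. p = h i \<and> q = g j \<and> \<sigma> i = Some j"
      using h' unfolding \<sigma>'_def by (auto split: if_splits intro!: exI[of _ "h' p"])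
  next
    assume "\<exists>i j. p = h i \<and> q = g j \<and> \<sigma> i = Some j"
    then obtain i j where "p = h i" "q = g j" "\<sigma> i = Some j" by blast
    moreover from this have "i \<in> I" using \<sigma>_pm(1) by blast
    ultimately show "\<sigma>' p = Some q" using hI by (simp add: \<sigma>'_def)
  qed
  have dom': "dom \<sigma>' = h ` dom \<sigma>" and ran': "ran \<sigma>' = g ` ran \<sigma>"
    by (auto simp: dom_def ran_def \<sigma>'_iff)
  have "inj_on \<sigma>' (dom \<sigma>')"
  proof (rule inj_onI)
    fix p q assume "p \<in> dom \<sigma>'" "q \<in> dom \<sigma>'" and eq: "\<sigma>' p = \<sigma>' q"
    then obtain r where "\<sigma>' p = Some r" "\<sigma>' q = Some r" by auto
    then obtain i j i' j' where ij: "p = h i" "r = g j" "\<sigma> i = Some j"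
      "q = h i'" "r = g j'" "\<sigma> i' = Some j'"
      unfolding \<sigma>'_iff by blast
    then have "j \<in> J" "j' \<in> J" using \<sigma>_pm(2) by (auto intro: ranI)
    then have "j = j'" using ij g_inj by (auto dest: inj_onD)
    then show "p = q" using ij \<sigma>_pm(3) by (metis domI inj_onD)
  qed
  then have "\<sigma>' \<in> partial_multibijections I' J'"
    using \<sigma>_pm hI(1) gJ by (auto simp: partial_multibijections_def dom' ran')
  moreover have "eps_trivial (2 * e) (X' p)" if "p \<in> I' - dom \<sigma>'" for p
  proof -
    have "h' p \<in> I - dom \<sigma>" using that h'[of p] unfolding dom' by (metis DiffE DiffI image_eqI)
    then have "eps_trivial (2 * e) (X (h' p))" using \<sigma> unfolding eps_matching_def by blast
    then show ?thesis using X[of "h' p"] h'[of p] that by simp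
  qed
  moreover have "eps_trivial (2 * e) (Y' q)" if q: "q \<in> J' - ran \<sigma>'" for q
  proof -
    obtain j where j: "j \<in> J" "q = g j" using q unfolding g_surj by blast
    then have "j \<in> J - ran \<sigma>" using q unfolding ran' by blast
    then have "eps_trivial (2 * e) (Y j)" using \<sigma> unfolding eps_matching_def by blast
    then show ?thesis using Y[OF j(1)] j(2) by simp
  qed
  moreover have "interleaved e (X' p) (Y' (the (\<sigma>' p)))" if p: "p \<in> dom \<sigma>'" for p
  proof -
    obtain i j where ij: "p = h i" "\<sigma> i = Some j" using p by (auto simp: dom')
    then have "\<sigma>' p = Some (g j)" by (auto simp: \<sigma>'_iff)
    moreover have "i \<in> dom \<sigma>" "i \<in> I" "j \<in> J" using ij \<sigma>_pm by (auto intro: ranI)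
    moreover from this have "interleaved e (X i) (Y (the (\<sigma> i)))"
      using \<sigma> unfolding eps_matching_def by blast
    ultimately show ?thesis using ij X Y by simp
  qed
  ultimately show ?thesis unfolding eps_matching_def by blast
qed

lemma bottleneck_dist_rect_sum:
  fixes M :: "('k::field, 'v::ab_group_add, 'n::finite) pmod" and N :: "('k, 'w::ab_group_add, 'n) pmod"
  assumes "isomorphic M (rect_sum I R)" "finite I" "\<And>i. i \<in> I \<Longrightarrow> rectangle (R i)"
    and "isomorphic N (rect_sum J Q)" "finite J" "\<And>j. j \<in> J \<Longrightarrow> rectangle (Q j)"
  shows "bottleneck_dist M N = Inf {ereal e | e. 0 \<le> e \<and>
    (\<exists>\<sigma>. eps_matching e I (\<lambda>i. rect_module (R i) :: ('k, 'k, 'n) pmod)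
      J (\<lambda>j. rect_module (Q j) :: ('k, 'k, 'n) pmod) \<sigma>)}"
proof -
  let ?A = "instances (image_mset R (mset_set I))" and ?B = "instances (image_mset Q (mset_set J))"
  obtain h where h: "bij_betw h I ?A" "\<And>i. i \<in> I \<Longrightarrow> fst (h i) = R i"
    using ex_bij_instances[OF assms(2)] by metis
  obtain g where g: "bij_betw g J ?B" "\<And>j. j \<in> J \<Longrightarrow> fst (g j) = Q j"
    using ex_bij_instances[OF assms(5)] by metis
  have h': "bij_betw (inv_into I h) ?A I" "\<And>p. p \<in> ?A \<Longrightarrow> R (inv_into I h p) = fst p"
    using bij_betw_inv_into[OF h(1)] h(2) bij_betw_inv_into_right[OF h(1)] bij_betwE[OF bij_betw_inv_into[OF h(1)]]
    by metis+
  have g': "bij_betw (inv_into J g) ?B J" "\<And>p. p \<in> ?B \<Longrightarrow> Q (inv_into J g p) = fst p"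
    using bij_betw_inv_into[OF g(1)] g(2) bij_betw_inv_into_right[OF g(1)] bij_betwE[OF bij_betw_inv_into[OF g(1)]]
    by metis+
  let ?F = "\<lambda>p :: (real^'n) set \<times> nat. rect_module (fst p) :: ('k, 'k, 'n) pmod"
  let ?X = "\<lambda>i. rect_module (R i) :: ('k, 'k, 'n) pmod"
  let ?Y = "\<lambda>j. rect_module (Q j) :: ('k, 'k, 'n) pmod"
  have "(\<exists>\<sigma>. eps_matching e ?A ?F ?B ?F \<sigma>) \<longleftrightarrow> (\<exists>\<sigma>. eps_matching e I ?X J ?Y \<sigma>)"
    (is "?L \<longleftrightarrow> ?R") for e
  proof
    assume ?L
    then obtain \<sigma> where \<sigma>: "eps_matching e ?A ?F ?B ?F \<sigma>" ..
    show ?R by (rule eps_matching_reindex[OF h'(1) g'(1) _ _ \<sigma>]) (simp_all add: h'(2) g'(2))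
  next
    assume ?R
    then obtain \<sigma> where \<sigma>: "eps_matching e I ?X J ?Y \<sigma>" ..
    show ?L by (rule eps_matching_reindex[OF h(1) g(1) _ _ \<sigma>]) (simp_all add: h(2) g(2))
  qed
  moreover have "barcode M = image_mset R (mset_set I)" "barcode N = image_mset Q (mset_set J)"
    using assms(1-3) assms(4-6) by (auto intro: barcode_eq)
  ultimately show ?thesis unfolding bottleneck_dist_def by simp
qed

section \<open>Costs of matchings and the bottleneck formula\<close>

lemma Max0_le_iff:
  assumes "finite A" "0 \<le> t"
  shows "Max0 A \<le> t \<longleftrightarrow> (\<forall>x\<in>A. x \<le> t)"
  using assms by (simp add: Max0_def)

lemma Max0_nonneg:
  assumes "finite A" "\<And>x. x \<in> A \<Longrightarrow> 0 \<le> x"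
  shows "0 \<le> Max0 A"
  using assms by (auto simp: Max0_def Max_ge_iff)

text \<open>The \<open>itself\<close> argument fixes the field, which otherwise occurs only in the
  types of the rectangle modules inside the body.\<close>

definition matching_cost ::
  "'k::field itself \<Rightarrow> 'i set \<Rightarrow> 'j set \<Rightarrow> ('i \<Rightarrow> ereal^'n::finite) \<Rightarrow> ('i \<Rightarrow> ereal^'n) \<Rightarrow>
    ('j \<Rightarrow> ereal^'n) \<Rightarrow> ('j \<Rightarrow> ereal^'n) \<Rightarrow> ('i \<rightharpoonup> 'j) \<Rightarrow> ereal" where
  "matching_cost _ I J a b c d \<sigma> =
    Max {Max0 ((\<lambda>i. interleaving_dist
             (rect_module (open_rect (a i) (b i)) :: ('k, 'k, 'n) pmod)
             (rect_module (open_rect (c (the (\<sigma> i))) (d (the (\<sigma> i)))) :: ('k, 'k, 'n) pmod)) ` dom \<sigma>),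
         Max0 ((\<lambda>i. half_width (a i) (b i)) ` (I - dom \<sigma>)),
         Max0 ((\<lambda>j. half_width (c j) (d j)) ` (J - ran \<sigma>))}"

lemma eps_matching_rect_iff:
  fixes a b :: "'i \<Rightarrow> ereal^'n::finite" and c d :: "'j \<Rightarrow> ereal^'n"
  assumes fin: "finite I" "finite J" and e: "0 \<le> e" and \<sigma>: "\<sigma> \<in> partial_multibijections I J"
    and ab: "\<And>i. i \<in> I \<Longrightarrow> proper_bounds (a i) (b i)" and cd: "\<And>j. j \<in> J \<Longrightarrow> proper_bounds (c j) (d j)"
  shows "eps_matching e I (\<lambda>i. rect_module (open_rect (a i) (b i)) :: ('k::field, 'k, 'n) pmod)
      J (\<lambda>j. rect_module (open_rect (c j) (d j)) :: ('k, 'k, 'n) pmod) \<sigma> \<longleftrightarrow>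
    matching_cost TYPE('k) I J a b c d \<sigma> \<le> ereal e"
proof -
  have sub: "dom \<sigma> \<subseteq> I" "ran \<sigma> \<subseteq> J" using \<sigma> by (auto simp: partial_multibijections_def)
  have fin': "finite (dom \<sigma>)" using sub fin finite_subset by blast
  \<comment> \<open>For general modules a distance of at most \<open>e\<close> need not give an
    \<open>e\<close>-interleaving. Here it does, because both sides compare the same closed formula
    with \<open>e\<close>.\<close>
  have "interleaved e (rect_module (open_rect (a i) (b i)) :: ('k, 'k, 'n) pmod)
      (rect_module (open_rect (c (the (\<sigma> i))) (d (the (\<sigma> i)))) :: ('k, 'k, 'n) pmod) \<longleftrightarrow>
    interleaving_dist (rect_module (open_rect (a i) (b i)) :: ('k, 'k, 'n) pmod)
      (rect_module (open_rect (c (the (\<sigma> i))) (d (the (\<sigma> i)))) :: ('k, 'k, 'n) pmod) \<le> ereal e"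
    if "i \<in> dom \<sigma>" for i
  proof -
    have "i \<in> I" "the (\<sigma> i) \<in> J" using that sub by (auto intro: ranI)
    then show ?thesis
      by (simp only: interleaving_dist_rect[OF ab cd] interleaved_rect_iff[OF ab cd e])
  qed
  moreover have "eps_trivial (2 * e) (rect_module (open_rect (a i) (b i)) :: ('k, 'k, 'n) pmod)
      \<longleftrightarrow> half_width (a i) (b i) \<le> ereal e" if "i \<in> I - dom \<sigma>" for i
    using that ab e by (intro eps_trivial_rect_iff) auto
  moreover have "eps_trivial (2 * e) (rect_module (open_rect (c j) (d j)) :: ('k, 'k, 'n) pmod)
      \<longleftrightarrow> half_width (c j) (d j) \<le> ereal e" if "j \<in> J - ran \<sigma>" for j
    using that cd e by (intro eps_trivial_rect_iff) auto
  ultimately show ?thesis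
    using \<sigma> fin fin' e unfolding eps_matching_def matching_cost_def
    by (simp add: Max0_le_iff) blast
qed

lemma matching_cost_nonneg:
  assumes "finite I" "\<And>i. i \<in> I \<Longrightarrow> proper_bounds (a i) (b i)"
  shows "0 \<le> matching_cost TYPE('k::field) I J a b c d \<sigma>"
proof -
  have "0 \<le> Max0 ((\<lambda>i. half_width (a i) (b i)) ` (I - dom \<sigma>))"
    using assms by (intro Max0_nonneg) (auto intro: half_width_nonneg)
  then show ?thesis unfolding matching_cost_def by (simp add: le_max_iff_disj)
qed

lemma bottleneck_dist_open_rect_sum:
  fixes M :: "('k::field, 'v::ab_group_add, 'n::finite) pmod" and N :: "('k, 'w::ab_group_add, 'n) pmod"
    and a b :: "'i \<Rightarrow> ereal^'n" and c d :: "'j \<Rightarrow> ereal^'n"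
  assumes fin: "finite I" "finite J"
    and ab: "\<And>i. i \<in> I \<Longrightarrow> proper_bounds (a i) (b i)" and cd: "\<And>j. j \<in> J \<Longrightarrow> proper_bounds (c j) (d j)"
    and M: "isomorphic M (rect_sum I (\<lambda>i. open_rect (a i) (b i)))"
    and N: "isomorphic N (rect_sum J (\<lambda>j. open_rect (c j) (d j)))"
  shows "bottleneck_dist M N = (MIN \<sigma>\<in>partial_multibijections I J. matching_cost TYPE('k) I J a b c d \<sigma>)"
proof -
  let ?S = "partial_multibijections I J" and ?C = "matching_cost TYPE('k) I J a b c d"
  have S: "finite ?S" "?S \<noteq> {}"
    using finite_partial_multibijections[OF fin]
    by (auto simp: partial_multibijections_def intro: exI[of _ Map.empty])
  let ?X = "\<lambda>i. rect_module (open_rect (a i) (b i)) :: ('k, 'k, 'n) pmod"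
  let ?Y = "\<lambda>j. rect_module (open_rect (c j) (d j)) :: ('k, 'k, 'n) pmod"
  \<comment> \<open>A matching for \<open>e\<close> is a \<sigma> of cost at most \<open>e\<close>.
    There are only finitely many candidates, among them the empty one, so the least cost is attained
    and decides whether such a \<sigma> exists.\<close>
  have "(\<exists>\<sigma>. eps_matching e I ?X J ?Y \<sigma>) \<longleftrightarrow> Min (?C ` ?S) \<le> ereal e"
    (is "?L \<longleftrightarrow> _") if e: "0 \<le> e" for e
  proof -
    have "eps_matching e I ?X J ?Y \<sigma> \<longleftrightarrow> \<sigma> \<in> ?S \<and> ?C \<sigma> \<le> ereal e" for \<sigma>
    proof (cases "\<sigma> \<in> ?S")
      case True
      then show ?thesis using eps_matching_rect_iff[OF fin e True ab cd] by simp
    next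
      case False
      then show ?thesis by (simp add: eps_matching_def)
    qed
    then have "?L \<longleftrightarrow> (\<exists>\<sigma>\<in>?S. ?C \<sigma> \<le> ereal e)" by blast
    then show ?thesis using S by (simp add: Min_le_iff)
  qed
  then have "{ereal e | e. 0 \<le> e \<and> (\<exists>\<sigma>. eps_matching e I ?X J ?Y \<sigma>)} =
    {ereal e | e. 0 \<le> e \<and> Min (?C ` ?S) \<le> ereal e}" by blast
  moreover have "0 \<le> Min (?C ` ?S)"
  proof -
    have "0 \<le> ?C \<sigma>" for \<sigma> by (rule matching_cost_nonneg[OF fin(1)]) (rule ab)
    then show ?thesis using S by simp
  qed
  ultimately show ?thesis
    by (simp only: Inf_ereal_ge bottleneck_dist_rect_sum[OF M fin(1) rectangle_open_rect[OF ab]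
        N fin(2) rectangle_open_rect[OF cd]])
qed

theorem theoremB:
  fixes M :: "('k::field, 'v::ab_group_add, 2) pmod"
    and N :: "('k, 'w::ab_group_add, 2) pmod"
    and m k :: nat
    and a b c d :: "nat \<Rightarrow> ereal^2"
  assumes "persistence_module M" and "persistence_module N"
    and "\<And>i s. i \<in> {1..m} \<Longrightarrow> a i $ s \<noteq> \<infinity> \<and> b i $ s \<noteq> -\<infinity> \<and> a i $ s < b i $ s"
    and "\<And>j s. j \<in> {1..k} \<Longrightarrow> c j $ s \<noteq> \<infinity> \<and> d j $ s \<noteq> -\<infinity> \<and> c j $ s < d j $ s"
    and "isomorphic M (direct_sum {1..m} (\<lambda>i. rect_module (open_rect (a i) (b i))))"
    and "isomorphic N (direct_sum {1..k} (\<lambda>j. rect_module (open_rect (c j) (d j))))"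
  shows "bottleneck_dist M N =
      (MIN \<sigma>\<in>partial_multibijections {1..m} {1..k}.
        Max {Max0 ((\<lambda>i. interleaving_dist
                     (rect_module (open_rect (a i) (b i)) :: ('k, 'k, 2) pmod)
                     (rect_module (open_rect (c (the (\<sigma> i))) (d (the (\<sigma> i)))) :: ('k, 'k, 2) pmod))
                   ` dom \<sigma>),
             Max0 ((\<lambda>i. MIN s. ext_diff (b i $ s) (a i $ s) / 2) ` ({1..m} - dom \<sigma>)),
             Max0 ((\<lambda>j. MIN s. ext_diff (d j $ s) (c j $ s) / 2) ` ({1..k} - ran \<sigma>))}) \<and>
    (\<forall>\<sigma>\<in>partial_multibijections {1..m} {1..k}. \<forall>i\<in>dom \<sigma>.
      interleaving_dist
        (rect_module (open_rect (a i) (b i)) :: ('k, 'k, 2) pmod)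
        (rect_module (open_rect (c (the (\<sigma> i))) (d (the (\<sigma> i)))) :: ('k, 'k, 2) pmod) =
      min (max (MIN s. ext_diff (b i $ s) (a i $ s) / 2)
               (MIN s. ext_diff (d (the (\<sigma> i)) $ s) (c (the (\<sigma> i)) $ s) / 2))
          (max (sup_norm_diff (c (the (\<sigma> i))) (a i))
               (sup_norm_diff (d (the (\<sigma> i))) (b i))))"
proof -
  have ab: "proper_bounds (a i) (b i)" if "i \<in> {1..m}" for i
    using assms(3)[OF that] by (simp add: proper_bounds_def)
  have cd: "proper_bounds (c j) (d j)" if "j \<in> {1..k}" for j
    using assms(4)[OF that] by (simp add: proper_bounds_def)
  have "interleaving_dist
        (rect_module (open_rect (a i) (b i)) :: ('k, 'k, 2) pmod)
        (rect_module (open_rect (c (the (\<sigma> i))) (d (the (\<sigma> i)))) :: ('k, 'k, 2) pmod) =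
      min (max (half_width (a i) (b i)) (half_width (c (the (\<sigma> i))) (d (the (\<sigma> i)))))
          (max (sup_norm_diff (c (the (\<sigma> i))) (a i)) (sup_norm_diff (d (the (\<sigma> i))) (b i)))"
    if "\<sigma> \<in> partial_multibijections {1..m} {1..k}" "i \<in> dom \<sigma>" for \<sigma> i
  proof (rule interleaving_dist_rect)
    show "proper_bounds (a i) (b i)"
      using that by (intro ab) (auto simp: partial_multibijections_def)
    show "proper_bounds (c (the (\<sigma> i))) (d (the (\<sigma> i)))"
      using that by (intro cd) (auto simp: partial_multibijections_def ran_def)
  qed
  with bottleneck_dist_open_rect_sum[OF _ _ ab cd assms(5,6)] show ?thesis
    unfolding matching_cost_def half_width_def by blast
qed

end
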